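(* The worst-case approximation ratio of greedy-weight for $\mathrm{MFD}_{\mathbb N}$ is $\Omega(m/\log m)$ on sparse graphs. That is, there exist constants $c, C>0$ and an infinite family of instances $(G,X)$, where $G=(V,E)$ is an $s$-$t$ DAG with $m=|E|\le C\,|V|$ and $m$ unbounded over the family, and $X\colon E\to\mathbb N$ is a flow, such that on each instance of the family the number of paths used by greedy-weight to decompose $X$ is at least $c\cdot\frac{m}{\log m}\cdot \mathrm{mfd}_{\mathbb N}(G,X)$.
   Context: An $s$-$t$ DAG is a directed acyclic graph $G=(V,E)$ with a unique source $s$ (no in-edges) and a unique sink $t$ (no out-edges). A flow is a function $X$ on $E$ such that at every node of $V\setminus\{s,t\}$ incoming flow equals outgoing flow. An $s$-$t$ path $P$ is identified with the flow that is $1$ on the edges of $P$ and $0$ elsewhere. A flow decomposition of $(G,X)$ of size $k$ with weights in $\mathbb N$ ($0\in\mathbb N$) is a family of $s$-$t$ paths $P_1,\dots,P_k$ with weights $w_1,\dots,w_k\in\mathbb N$ such that $X=w_1P_1+\dots+w_kP_k$; $\mathrm{mfd}_{\mathbb N}(G,X)$ is the smallest size of such a decomposition, and $\mathrm{MFD}_{\mathbb N}$ is the problem of finding one of smallest size. A path $P$ carries flow $p$ if $X(e)\ge p$ for every edge $e$ of $P$. Greedy-weight is the algorithm that, starting from $X$, repeatedly picks a heaviest path, i.e. an $s$-$t$ path carrying the largest possible flow $p$ in the current remaining flow (ties broken arbitrarily), adds it to the decomposition with weight $p$, and subtracts $p$ from the remaining flow on each of its edges, until the remaining flow is $0$. 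*)

theory Defs
  imports Complex_Main "Graph_Theory.Digraph" "Graph_Theory.Arc_Walk"
begin

text \<open>The locale \<^locale>\<open>digraph\<close> provides finite graphs without loops or parallel arcs, so that
  the arcs amount to a set \<open>E \<subseteq> V \<times> V\<close>.\<close>

locale st_dag = digraph G for G :: "('a, 'b) pre_digraph" and s t :: 'a +
  assumes acyclic: "acyclic (arcs_ends G)"
    and s_in_verts: "s \<in> verts G"
    and t_in_verts: "t \<in> verts G"
    and unique_source: "\<And>v. v \<in> verts G \<Longrightarrow> in_arcs G v = {} \<longleftrightarrow> v = s"
    and unique_sink: "\<And>v. v \<in> verts G \<Longrightarrow> out_arcs G v = {} \<longleftrightarrow> v = t"

text \<open>Only the values of a flow on \<open>arcs G\<close> are meaningful; values elsewhere are never consulted.\<close>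

definition is_flow :: "('a, 'b) pre_digraph \<Rightarrow> 'a \<Rightarrow> 'a \<Rightarrow> ('b \<Rightarrow> nat) \<Rightarrow> bool" where
  "is_flow G s t X \<longleftrightarrow>
     (\<forall>v \<in> verts G - {s, t}. (\<Sum>e\<in>in_arcs G v. X e) = (\<Sum>e\<in>out_arcs G v. X e))"

definition path_flow :: "'b list \<Rightarrow> 'b \<Rightarrow> nat" where
  "path_flow P e = (if e \<in> set P then 1 else 0)"

text \<open>A family of paths \<open>P\<^sub>1, \<dots>, P\<^sub>k\<close> with weights \<open>w\<^sub>1, \<dots>, w\<^sub>k\<close> is the list of the pairs
  \<open>(P\<^sub>i, w\<^sub>i)\<close>; its size is the length of the list.\<close>

definition flow_decomposition ::
    "('a, 'b) pre_digraph \<Rightarrow> 'a \<Rightarrow> 'a \<Rightarrow> ('b \<Rightarrow> nat) \<Rightarrow> ('b list \<times> nat) list \<Rightarrow> bool" where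
  "flow_decomposition G s t X D \<longleftrightarrow>
     (\<forall>(P, w) \<in> set D. pre_digraph.apath G s P t) \<and>
     (\<forall>e \<in> arcs G. X e = (\<Sum>(P, w)\<leftarrow>D. w * path_flow P e))"

definition mfd :: "('a, 'b) pre_digraph \<Rightarrow> 'a \<Rightarrow> 'a \<Rightarrow> ('b \<Rightarrow> nat) \<Rightarrow> nat" where
  "mfd G s t X = (LEAST k. \<exists>D. flow_decomposition G s t X D \<and> length D = k)"

definition carries :: "('b \<Rightarrow> nat) \<Rightarrow> 'b list \<Rightarrow> nat \<Rightarrow> bool" where
  "carries X P p \<longleftrightarrow> (\<forall>e \<in> set P. X e \<ge> p)"

definition heaviest_path ::
    "('a, 'b) pre_digraph \<Rightarrow> 'a \<Rightarrow> 'a \<Rightarrow> ('b \<Rightarrow> nat) \<Rightarrow> 'b list \<Rightarrow> nat \<Rightarrow> bool" where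
  "heaviest_path G s t X P p \<longleftrightarrow>
     pre_digraph.apath G s P t \<and> carries X P p \<and>
     (\<forall>Q q. pre_digraph.apath G s Q t \<and> carries X Q q \<longrightarrow> q \<le> p)"

text \<open>\<open>greedy_weight G s t X D\<close> holds iff \<open>D\<close> is the output of some complete run of the algorithm on
  \<open>X\<close>, that is, for some way of breaking ties. The truncated subtraction is exact, because the
  chosen path carries \<open>p\<close>.\<close>

inductive greedy_weight ::
    "('a, 'b) pre_digraph \<Rightarrow> 'a \<Rightarrow> 'a \<Rightarrow> ('b \<Rightarrow> nat) \<Rightarrow> ('b list \<times> nat) list \<Rightarrow> bool"
  for G s t where
  finished: "(\<forall>e \<in> arcs G. X e = 0) \<Longrightarrow> greedy_weight G s t X []"
| step: "(\<exists>e \<in> arcs G. X e \<noteq> 0) \<Longrightarrow> heaviest_path G s t X P p \<Longrightarrow>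
    greedy_weight G s t (\<lambda>e. X e - p * path_flow P e) D \<Longrightarrow>
    greedy_weight G s t X ((P, p) # D)"

end

theory Submission
  imports Defs
begin

text \<open>The instances live on the square of a path: vertices \<open>0, \<dots>, 2n - 1\<close> with arcs \<open>(v, v + 1)\<close> and
  \<open>(v, v + 2)\<close>, where \<open>n = 2\<^sup>k\<close>. The flow carries at least \<open>n\<close> on every arc \<open>(v, v + 1)\<close> and less
  than \<open>n\<close> on every arc \<open>(v, v + 2)\<close>. So the heaviest path is the spine \<open>0, 1, \<dots>, 2n - 1\<close> with
  weight \<open>n\<close>, and removing it erases all arcs \<open>(2i + 1, 2i + 2)\<close>. In the flow that remains, every
  path uses exactly one of the \<open>n\<close> rungs \<open>(2i, 2i + 1)\<close>, each of which carries one unit; hence greedy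
  needs \<open>n\<close> further paths.

  In contrast, a path is determined by the set of vertices it skips, and for a flow of given value
  it suffices that each vertex is skipped with the right total weight: \<open>i\<close> for vertex \<open>2i\<close> and
  \<open>n - 1 - i\<close> for vertex \<open>2i + 1\<close>. Reading these numbers in binary, \<open>k\<close> paths of weights \<open>2\<^sup>j\<close>
  that skip even vertices only, \<open>k\<close> such paths that skip odd vertices only, and the spine with
  weight 2 form a decomposition.\<close>

section \<open>The ladder graph and its flow\<close>

definition ladder :: "nat \<Rightarrow> (nat, nat \<times> nat) pre_digraph" where
  "ladder n = \<lparr>verts = {..<2 * n}, arcs = {(u, v). (v = u + 1 \<or> v = u + 2) \<and> v < 2 * n},
     tail = fst, head = snd\<rparr>"

text \<open>The flow left over by the first greedy path.\<close>
definition residual :: "nat \<Rightarrow> nat \<times> nat \<Rightarrow> nat" where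
  "residual n = (\<lambda>(u, v). if v = u + 1 then of_bool (even u)
     else if even u then n - 1 - u div 2 else u div 2 + 1)"

definition ladder_flow :: "nat \<Rightarrow> nat \<times> nat \<Rightarrow> nat" where
  "ladder_flow n = (\<lambda>(u, v). residual n (u, v) + (if v = u + 1 then n else 0))"

lemma ladder_sel [simp]:
  "verts (ladder n) = {..<2 * n}"
  "(u, v) \<in> arcs (ladder n) \<longleftrightarrow> (v = u + 1 \<or> v = u + 2) \<and> v < 2 * n"
  "tail (ladder n) = fst" "head (ladder n) = snd"
  by (auto simp: ladder_def)

lemma arcs_ladder:
  "arcs (ladder n) = (\<lambda>u. (u, u + 1)) ` {..<2 * n - 1} \<union> (\<lambda>u. (u, u + 2)) ` {..<2 * n - 2}"
  by (auto simp: ladder_def)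

lemma finite_arcs_ladder [simp]: "finite (arcs (ladder n))"
  by (simp add: arcs_ladder)

lemma card_arcs_ladder:
  assumes "n > 0"
  shows "card (arcs (ladder n)) = 4 * n - 3"
proof -
  have "card (arcs (ladder n)) =
      card ((\<lambda>u. (u, u + 1)) ` {..<2 * n - 1}) + card ((\<lambda>u. (u, u + 2)) ` {..<2 * n - 2})"
    unfolding arcs_ladder by (rule card_Un_disjoint) auto
  also have "\<dots> = (2 * n - 1) + (2 * n - 2)"
    by (subst (1 2) card_image) (auto simp: inj_on_def)
  finally show ?thesis
    using assms by simp
qed

lemma in_arcs_ladder:
  assumes "v < 2 * n"
  shows "in_arcs (ladder n) v =
    (if v \<ge> 1 then {(v - 1, v)} else {}) \<union> (if v \<ge> 2 then {(v - 2, v)} else {})"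
  using assms by (auto simp: in_arcs_def)

lemma out_arcs_ladder:
  "out_arcs (ladder n) v =
    (if v + 1 < 2 * n then {(v, v + 1)} else {}) \<union> (if v + 2 < 2 * n then {(v, v + 2)} else {})"
  by (auto simp: out_arcs_def)

lemma st_dag_ladder:
  assumes "n > 0"
  shows "st_dag (ladder n) 0 (2 * n - 1)"
proof unfold_locales
  have "arcs_ends (ladder n) \<subseteq> less_than"
    by (auto simp: arcs_ends_conv)
  then show "acyclic (arcs_ends (ladder n))"
    by (rule acyclic_subset[OF wf_acyclic[OF wf_less_than]])
qed (use assms in \<open>auto simp: in_arcs_ladder out_arcs_ladder arc_to_ends_def\<close>)

lemma is_flow_ladder:
  "is_flow (ladder n) 0 (2 * n - 1) (ladder_flow n)"
  unfolding is_flow_def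
proof
  fix v
  assume v: "v \<in> verts (ladder n) - {0, 2 * n - 1}"
  consider i where "v = 2 * i" | i where "v = 2 * i + 1"
    by (metis oddE evenE)
  then show "(\<Sum>e\<in>in_arcs (ladder n) v. ladder_flow n e) = (\<Sum>e\<in>out_arcs (ladder n) v. ladder_flow n e)"
  proof cases
    case 1
    \<comment> \<open>The vertex \<open>2 * n - 2\<close> has no long out-arc; the value
      \<open>n - 1 - i\<close> which such an arc would carry is 0 there, so the balance is the
      same.\<close>
    have "i = n - 1 \<or> i + 1 < n"
      using v 1 by auto
    then show ?thesis
      using v 1
      by (cases i) (auto simp: in_arcs_ladder out_arcs_ladder ladder_flow_def residual_def)
  next
    case 2
    then have "i + 1 < n"
      using v by auto
    then show ?thesis
      using v 2 by (cases i) (auto simp: in_arcs_ladder out_arcs_ladder ladder_flow_def residual_def)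
  qed
qed

section \<open>Walks and paths in the ladder\<close>

lemmas walk_defs = pre_digraph.awalk_def pre_digraph.cas.simps pre_digraph.awalk_verts.simps

text \<open>A discrete intermediate value argument: the first arc either crosses the cut after
  \<open>c\<close> or leads to a vertex that is still at most \<open>c\<close>.\<close>

lemma cas_ladder_crossing:
  assumes "pre_digraph.cas (ladder n) u P w" "u \<le> c" "c < w"
  shows "\<exists>(x, y)\<in>set P. x \<le> c \<and> c < y"
  using assms
proof (induction P arbitrary: u)
  case (Cons e P)
  then show ?case
    by (cases e; cases "snd e \<le> c") (auto simp: walk_defs)
qed (auto simp: walk_defs)

lemma awalk_verts_ladder_ge:
  assumes "set P \<subseteq> arcs (ladder n)" "pre_digraph.cas (ladder n) u P w"
  shows "\<forall>x\<in>set (pre_digraph.awalk_verts (ladder n) u P). u \<le> x"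
  using assms by (induction P arbitrary: u) (fastforce simp: walk_defs)+

text \<open>Arcs lead to larger vertices, so a walk never revisits one and distinctness is
  automatic.\<close>

lemma apath_ladder_iff:
  "pre_digraph.apath (ladder n) u P w \<longleftrightarrow>
     u < 2 * n \<and> set P \<subseteq> arcs (ladder n) \<and> pre_digraph.cas (ladder n) u P w"
proof -
  have "distinct (pre_digraph.awalk_verts (ladder n) u P)"
    if "set P \<subseteq> arcs (ladder n)" "pre_digraph.cas (ladder n) u P w"
    using that
  proof (induction P arbitrary: u)
    case (Cons e P)
    then show ?case
      using awalk_verts_ladder_ge[of P n "snd e" w] by (cases e) (fastforce simp: walk_defs)
  qed (auto simp: walk_defs)
  then show ?thesis
    by (auto simp: pre_digraph.apath_def walk_defs)
qed

lemma cas_ladder_snoc: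
  "pre_digraph.cas (ladder n) u (P @ [(v, w)]) x \<longleftrightarrow> pre_digraph.cas (ladder n) u P v \<and> w = x"
  by (induction P arbitrary: u) (auto simp: walk_defs)

section \<open>Paths described by the vertices they skip\<close>

text \<open>A long arc jumps over a single vertex, hence no two consecutive vertices may lie in
  \<open>S\<close>. The path is built backwards from its end \<open>w\<close>.\<close>

lemma ex_apath_skipping:
  assumes "\<And>v. v \<in> S \<Longrightarrow> Suc v \<notin> S" "0 \<notin> S" "w \<notin> S" "w < 2 * n"
  shows "\<exists>P. pre_digraph.apath (ladder n) 0 P w \<and>
    set P = {(u, v). (v = u + 1 \<or> v = u + 2 \<and> u + 1 \<in> S) \<and> u \<notin> S \<and> v \<notin> S \<and> v \<le> w}"
    (is "\<exists>P. _ \<and> set P = ?A w")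
  using assms(3,4)
proof (induction w rule: less_induct)
  case (less w)
  show ?case
  proof (cases "w = 0")
    case True
    then show ?thesis
      by (intro exI[of _ "[]"]) (use less in \<open>auto simp: apath_ladder_iff walk_defs\<close>)
  next
    case False
    \<comment> \<open>The predecessor of \<open>w\<close> on the path is \<open>w - 1\<close>, or
      \<open>w - 2\<close> if \<open>w - 1\<close> is to be skipped.\<close>
    have "\<exists>v < w. v \<notin> S \<and> (w = v + 1 \<or> w = v + 2 \<and> v + 1 \<in> S)"
    proof (cases "w - 1 \<in> S")
      case True
      then have "w \<noteq> 1"
        using assms(2) by auto
      then have "w = w - 2 + 2" "w - 1 = Suc (w - 2)"
        using False by auto
      moreover have "w - 2 \<notin> S"
        using True assms(1)[of "w - 2"] \<open>w - 1 = Suc (w - 2)\<close> by auto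
      ultimately show ?thesis
        using True by (intro exI[of _ "w - 2"]) auto
    next
      case w: False
      then show ?thesis
        using False by (intro exI[of _ "w - 1"]) auto
    qed
    then obtain v where v: "v < w" "v \<notin> S" "w = v + 1 \<or> w = v + 2 \<and> v + 1 \<in> S"
      by blast
    obtain P where P: "pre_digraph.apath (ladder n) 0 P v" "set P = ?A v"
      using less.IH[OF v(1,2)] v(1) less.prems(2) by auto
    have "insert (v, w) (?A v) = ?A w"
      using v(2,3) less.prems(1) by (elim disjE) (auto simp: le_Suc_eq)
    then have "set (P @ [(v, w)]) = ?A w"
      using P(2) by simp
    moreover have "pre_digraph.apath (ladder n) 0 (P @ [(v, w)]) w"
      using P(1) v(3) less.prems(2) unfolding apath_ladder_iff cas_ladder_snoc by auto
    ultimately show ?thesis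
      by blast
  qed
qed

definition skipping_path :: "nat \<Rightarrow> nat set \<Rightarrow> (nat \<times> nat) list \<Rightarrow> bool" where
  "skipping_path n S P \<longleftrightarrow> pre_digraph.apath (ladder n) 0 P (2 * n - 1) \<and>
     (\<forall>u v. (u, v) \<in> arcs (ladder n) \<longrightarrow>
        path_flow P (u, v) = of_bool (u \<notin> S \<and> v \<notin> S \<and> (v = u + 2 \<longrightarrow> u + 1 \<in> S)))"

lemma ex_skipping_path:
  assumes "\<And>v. v \<in> S \<Longrightarrow> Suc v \<notin> S" "0 \<notin> S" "2 * n - 1 \<notin> S" "n > 0"
  shows "\<exists>P. skipping_path n S P"
proof -
  obtain P where P: "pre_digraph.apath (ladder n) 0 P (2 * n - 1)"
    "set P = {(u, v). (v = u + 1 \<or> v = u + 2 \<and> u + 1 \<in> S) \<and> u \<notin> S \<and> v \<notin> S \<and> v \<le> 2 * n - 1}"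
    using ex_apath_skipping[OF assms(1-3), of n] assms(4) by auto
  have "path_flow P (u, v) = of_bool (u \<notin> S \<and> v \<notin> S \<and> (v = u + 2 \<longrightarrow> u + 1 \<in> S))"
    if "(u, v) \<in> arcs (ladder n)" for u v
    using that by (auto simp: path_flow_def P(2))
  with P(1) show ?thesis
    unfolding skipping_path_def by blast
qed

lemma skipping_path_apath:
  "skipping_path n S P \<Longrightarrow> pre_digraph.apath (ladder n) 0 P (2 * n - 1)"
  by (simp add: skipping_path_def)

lemma skipping_path_flow:
  assumes "skipping_path n S P" "(u, v) \<in> arcs (ladder n)"
  shows "path_flow P (u, v) = of_bool (u \<notin> S \<and> v \<notin> S \<and> (v = u + 2 \<longrightarrow> u + 1 \<in> S))"
  using assms unfolding skipping_path_def by blast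

section \<open>Greedy runs and their forced first path\<close>

text \<open>Lets a remaining flow be replaced by an explicit function such as
  \<open>residual\<close>, with which it is known to agree on arcs only.\<close>

lemma greedy_weight_cong:
  assumes "greedy_weight G s t X D" "\<And>e. e \<in> arcs G \<Longrightarrow> X e = Y e"
  shows "greedy_weight G s t Y D"
  using assms
proof (induction arbitrary: Y)
  case (finished X)
  then show ?case
    by (intro greedy_weight.finished) auto
next
  case (step X P p D)
  have carries: "carries X Q q \<longleftrightarrow> carries Y Q q" if "pre_digraph.apath G s Q t" for Q q
    using that step.prems
    by (force simp: carries_def pre_digraph.apath_def pre_digraph.awalk_def)
  show ?case
  proof (rule greedy_weight.step)
    show "heaviest_path G s t Y P p"
      using step.hyps(2) carries by (auto simp: heaviest_path_def)
  qed (use step in auto)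
qed

lemma crossing_arc:
  assumes "pre_digraph.apath (ladder n) 0 P (2 * n - 1)" "c + 1 < 2 * n"
  shows "\<exists>u v. (u, v) \<in> set P \<and> (u, v) \<in> arcs (ladder n) \<and> u \<le> c \<and> c < v"
proof -
  have P: "set P \<subseteq> arcs (ladder n)" "pre_digraph.cas (ladder n) 0 P (2 * n - 1)"
    using assms(1) by (auto simp: apath_ladder_iff)
  have "c < 2 * n - 1"
    using assms(2) by simp
  from cas_ladder_crossing[OF P(2) _ this] P(1) show ?thesis
    by fastforce
qed

lemma residual_less:
  assumes "(u, u + 2) \<in> arcs (ladder n)"
  shows "residual n (u, u + 2) < n"
  using assms by (cases "even u") (auto simp: residual_def elim!: evenE oddE)

lemma long_arc_notin_path:
  assumes "pre_digraph.apath (ladder n) 0 P (2 * n - 1)" "carries (ladder_flow n) P p" "n \<le> p"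
  shows "(u, u + 2) \<notin> set P"
proof
  assume u: "(u, u + 2) \<in> set P"
  then have "(u, u + 2) \<in> arcs (ladder n)"
    using assms(1) by (auto simp: apath_ladder_iff)
  moreover have "p \<le> ladder_flow n (u, u + 2)"
    using u assms(2) by (auto simp: carries_def)
  ultimately show False
    using residual_less assms(3) by (fastforce simp: ladder_flow_def)
qed

text \<open>The path has to cross the cut between \<open>c\<close> and \<open>c + 1\<close>. Long
  arcs carry less than \<open>n\<close>, and the only short arc over this cut is
  \<open>(c, c + 1)\<close>.\<close>

lemma spine_in_path:
  assumes "pre_digraph.apath (ladder n) 0 P (2 * n - 1)" "carries (ladder_flow n) P p" "n \<le> p"
    "c + 1 < 2 * n"
  shows "(c, c + 1) \<in> set P"
proof -
  obtain u v where uv: "(u, v) \<in> set P" "(u, v) \<in> arcs (ladder n)" "u \<le> c" "c < v"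
    using crossing_arc[OF assms(1,4)] by blast
  then have "v = u + 1"
    using long_arc_notin_path[OF assms(1-3), of u] by auto
  with uv show ?thesis
    using le_neq_implies_less by fastforce
qed

lemma carries_spine_le:
  assumes "pre_digraph.apath (ladder n) 0 P (2 * n - 1)" "carries (ladder_flow n) P p" "n \<ge> 2"
  shows "p \<le> n"
proof (rule ccontr)
  assume "\<not> p \<le> n"
  \<comment> \<open>The bottleneck of the spine: the tail of \<open>(1, 2)\<close> is odd, so this
    arc carries exactly \<open>n\<close>. It exists because \<open>n \<ge> 2\<close>.\<close>
  then have "(1, 1 + 1) \<in> set P"
    using assms by (intro spine_in_path[OF assms(1,2)]) auto
  then have "p \<le> ladder_flow n (1, 1 + 1)"
    using assms(2) by (auto simp: carries_def)
  with \<open>\<not> p \<le> n\<close> show False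
    by (simp add: ladder_flow_def residual_def)
qed

lemma ex_heaviest_first_path:
  assumes "n \<ge> 2"
  shows "\<exists>P. heaviest_path (ladder n) 0 (2 * n - 1) (ladder_flow n) P n"
proof -
  \<comment> \<open>The path that skips no vertex is the spine.\<close>
  have "\<exists>M. skipping_path n {} M"
    using assms by (intro ex_skipping_path) auto
  then obtain M where M: "skipping_path n {} M"
    by blast
  have "n \<le> ladder_flow n (u, v)" if "(u, v) \<in> set M" for u v
  proof -
    have uv: "(u, v) \<in> arcs (ladder n)"
      using that skipping_path_apath[OF M] unfolding apath_ladder_iff by blast
    have "v \<noteq> u + 2"
      using skipping_path_flow[OF M uv] that by (simp add: path_flow_def of_bool_def split: if_splits)
    then have "v = u + 1"
      using uv by simp
    then show ?thesis
      by (simp add: ladder_flow_def)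
  qed
  then have "carries (ladder_flow n) M n"
    unfolding carries_def by fast
  with skipping_path_apath[OF M] show ?thesis
    using carries_spine_le assms unfolding heaviest_path_def by blast
qed

text \<open>Ties play no part in the first step: the spine carries \<open>n\<close>, so a heaviest
  path carries at least \<open>n\<close>, which keeps it off all long arcs.\<close>

lemma heaviest_first_path:
  assumes "heaviest_path (ladder n) 0 (2 * n - 1) (ladder_flow n) P p" "n \<ge> 2"
  shows "p = n" "\<And>u v. (u, v) \<in> arcs (ladder n) \<Longrightarrow> path_flow P (u, v) = of_bool (v = u + 1)"
proof -
  have P: "pre_digraph.apath (ladder n) 0 P (2 * n - 1)" "carries (ladder_flow n) P p"
    using assms(1) by (auto simp: heaviest_path_def)
  have "n \<le> p"
    using ex_heaviest_first_path[OF assms(2)] assms(1) unfolding heaviest_path_def by blast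
  then show "p = n"
    using carries_spine_le[OF P assms(2)] by simp
  show "path_flow P (u, v) = of_bool (v = u + 1)" if "(u, v) \<in> arcs (ladder n)" for u v
    using that spine_in_path[OF P \<open>n \<le> p\<close>, of u] long_arc_notin_path[OF P \<open>n \<le> p\<close>, of u]
    by (auto simp: path_flow_def)
qed

lemma residual_after_first:
  assumes "heaviest_path (ladder n) 0 (2 * n - 1) (ladder_flow n) P p" "n \<ge> 2"
    "e \<in> arcs (ladder n)"
  shows "ladder_flow n e - p * path_flow P e = residual n e"
  using heaviest_first_path[OF assms(1,2)] assms(3)
  by (cases e) (auto simp: ladder_flow_def)

section \<open>Lower bound on the length of greedy runs\<close>

text \<open>Without arcs \<open>(2i + 1, 2i + 2)\<close>, the parity of the vertices along a walk can change
  only once, from even to odd.\<close>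
lemma rungs_of_walk:
  assumes "set P \<subseteq> arcs (ladder n)" "pre_digraph.cas (ladder n) u P w"
    "\<And>i. (2 * i + 1, 2 * i + 2) \<notin> set P"
  shows "(\<Sum>i<n. path_flow P (2 * i, 2 * i + 1)) + of_bool (odd u) \<le> of_bool (odd w)"
  using assms
proof (induction P arbitrary: u)
  case Nil
  then show ?case
    by (simp add: path_flow_def walk_defs)
next
  case (Cons e P)
  obtain v where e: "e = (u, v)" "(u, v) \<in> arcs (ladder n)"
    using Cons.prems by (cases e) (auto simp: walk_defs)
  let ?r = "\<lambda>i. of_bool (e = (2 * i, 2 * i + 1)) :: nat"
  have IH: "(\<Sum>i<n. path_flow P (2 * i, 2 * i + 1)) + of_bool (odd v) \<le> of_bool (odd w)"
    using Cons.prems e by (intro Cons.IH) (auto simp: walk_defs)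
  \<comment> \<open>Only an inequality, as \<open>path_flow\<close> records membership and not
    multiplicity.\<close>
  have "(\<Sum>i<n. path_flow (e # P) (2 * i, 2 * i + 1)) \<le>
      (\<Sum>i<n. ?r i + path_flow P (2 * i, 2 * i + 1))"
    by (intro sum_mono) (simp add: path_flow_def)
  then have split: "(\<Sum>i<n. path_flow (e # P) (2 * i, 2 * i + 1)) \<le>
      sum ?r {..<n} + (\<Sum>i<n. path_flow P (2 * i, 2 * i + 1))"
    by (simp only: sum.distrib)
  \<comment> \<open>A rung leads from even to odd, a long arc keeps the parity, and short arcs with
    odd tail are excluded.\<close>
  have first: "sum ?r {..<n} + of_bool (odd u) \<le> of_bool (odd v)"
  proof (cases "v = u + 1")
    case True
    have "even u"
    proof (rule ccontr)
      assume "odd u"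
      then obtain i where "u = 2 * i + 1"
        by (rule oddE)
      then show False
        using Cons.prems(3)[of i] True e by simp
    qed
    then obtain j where j: "u = 2 * j"
      by blast
    have "sum ?r {..<n} = (\<Sum>i<n. if j = i then 1 else 0)"
      unfolding e(1) True j by (intro sum.cong) simp_all
    also have "\<dots> \<le> 1"
      by simp
    finally show ?thesis
      using True j by simp
  next
    case False
    then have v: "v = u + 2"
      using e(2) by simp
    have "sum ?r {..<n} = 0"
      unfolding e(1) v by (intro sum.neutral) simp
    then show ?thesis
      using v by simp
  qed
  show ?case
    using add_mono[OF split first] IH by (simp only: add.assoc)
qed

lemma cas_ladder_parity:
  assumes "pre_digraph.cas (ladder n) u P w" "\<And>x y. (x, y) \<in> set P \<Longrightarrow> even x = even y"
  shows "even u = even w"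
  using assms
proof (induction P arbitrary: u)
  case (Cons e P)
  obtain v where e: "e = (u, v)" "pre_digraph.cas (ladder n) v P w"
    using Cons.prems(1) by (cases e) (auto simp: walk_defs)
  then have "even v = even w"
    using Cons.prems(2) by (intro Cons.IH) auto
  then show ?case
    using Cons.prems(2)[of u v] e(1) by simp
qed (simp add: walk_defs)

text \<open>The total flow on the rungs is a potential that drops by at most 1 in each step,
  whichever heaviest path is chosen. Being bounded by \<open>residual\<close> survives every
  subtraction, so it can serve as the invariant.\<close>

lemma greedy_weight_length_ge:
  assumes "greedy_weight (ladder n) 0 (2 * n - 1) Y D"
    "\<And>e. e \<in> arcs (ladder n) \<Longrightarrow> Y e \<le> residual n e"
  shows "(\<Sum>i<n. Y (2 * i, 2 * i + 1)) \<le> length D"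
  using assms(1,2)
proof induction
  case (finished Y)
  then have "(\<Sum>i<n. Y (2 * i, 2 * i + 1)) = 0"
    by (intro sum.neutral) auto
  then show ?case
    by simp
next
  case (step Y P p D)
  have P: "pre_digraph.apath (ladder n) 0 P (2 * n - 1)" "carries Y P p"
    using step.hyps(2) by (auto simp: heaviest_path_def)
  have IH: "(\<Sum>i<n. Y (2 * i, 2 * i + 1) - p * path_flow P (2 * i, 2 * i + 1)) \<le> length D"
    using step.IH step.prems le_trans diff_le_self by meson
  have le1: "(\<Sum>i<n. p * path_flow P (2 * i, 2 * i + 1)) \<le> 1"
  proof (cases "p = 0")
    case False
    have arc: "e \<in> arcs (ladder n)" "p \<le> residual n e" if "e \<in> set P" for e
    proof -
      show "e \<in> arcs (ladder n)"
        using that P(1) by (auto simp: apath_ladder_iff)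
      then show "p \<le> residual n e"
        using that P(2) step.prems[of e] by (force simp: carries_def)
    qed
    have "(\<Sum>i<n. path_flow P (2 * i, 2 * i + 1)) + of_bool (odd (0 :: nat)) \<le> of_bool (odd (2 * n - 1))"
    proof (rule rungs_of_walk)
      \<comment> \<open>These arcs have residual 0, whereas the path carries
        \<open>p > 0\<close>.\<close>
      show "(2 * i + 1, 2 * i + 2) \<notin> set P" for i
        using arc(2)[of "(2 * i + 1, 2 * i + 2)"] False by (auto simp: residual_def)
    qed (use P(1) in \<open>auto simp: apath_ladder_iff\<close>)
    then have "(\<Sum>i<n. path_flow P (2 * i, 2 * i + 1)) \<le> 1"
      by (simp add: of_bool_def split: if_splits)
    \<comment> \<open>Rungs have residual 1, so \<open>p \<le> 1\<close> as soon as the path uses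
      one.\<close>
    have "p * path_flow P (2 * i, 2 * i + 1) \<le> path_flow P (2 * i, 2 * i + 1)" for i
      using arc(2)[of "(2 * i, 2 * i + 1)"] by (auto simp: residual_def path_flow_def)
    then have "(\<Sum>i<n. p * path_flow P (2 * i, 2 * i + 1)) \<le> (\<Sum>i<n. path_flow P (2 * i, 2 * i + 1))"
      by (rule sum_mono)
    also have "\<dots> \<le> 1"
      by fact
    finally show ?thesis .
  qed simp
  have "(\<Sum>i<n. Y (2 * i, 2 * i + 1)) \<le>
      (\<Sum>i<n. (Y (2 * i, 2 * i + 1) - p * path_flow P (2 * i, 2 * i + 1)) + p * path_flow P (2 * i, 2 * i + 1))"
    by (intro sum_mono) simp
  also have "\<dots> \<le> length D + 1"
    unfolding sum.distrib by (rule add_mono[OF IH le1])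
  finally show ?case
    by simp
qed

lemma greedy_weight_ladder_length:
  assumes "greedy_weight (ladder n) 0 (2 * n - 1) (ladder_flow n) D" "n \<ge> 2"
  shows "length D \<ge> n + 1"
  using assms(1)
proof cases
  case finished
  moreover have "(0, 1) \<in> arcs (ladder n)" "ladder_flow n (0, 1) \<noteq> 0"
    using assms(2) by (auto simp: ladder_flow_def residual_def)
  ultimately show ?thesis
    by metis
next
  case (step P p D')
  \<comment> \<open>The left-hand side is \<open>n\<close>; the first path supplies the additional
    1.\<close>
  have "(\<Sum>i<n. residual n (2 * i, 2 * i + 1)) \<le> length D'"
    by (rule greedy_weight_length_ge[OF greedy_weight_cong[OF step(4)]])
      (use residual_after_first[OF step(3) assms(2)] assms(2) in auto)
  then show ?thesis
    using step(1) by (simp add: residual_def)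
qed

section \<open>Unit paths and the existence of a greedy run\<close>

text \<open>Rungs, short arcs between rungs, long arcs on the even side and long arcs on the odd
  side: \<open>residual\<close> has one formula for each kind.\<close>

lemma ladder_arc_cases [consumes 1]:
  assumes "(u, v) \<in> arcs (ladder n)"
  obtains j where "u = 2 * j" "v = 2 * j + 1" "j < n"
    | j where "u = 2 * j + 1" "v = 2 * j + 2" "j + 1 < n"
    | j where "u = 2 * j" "v = 2 * j + 2" "j + 1 < n"
    | j where "u = 2 * j + 1" "v = 2 * j + 3" "j + 1 < n"
proof -
  have v: "v = u + 1 \<or> v = u + 2" "v < 2 * n"
    using assms by simp_all
  obtain j where "u = 2 * j \<or> u = 2 * j + 1"
    by (metis evenE oddE)
  with v that[of j] show ?thesis
    by fastforce
qed

text \<open>The path follows the even vertices up to \<open>2 * i\<close>, takes the rung there and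
  continues along the odd vertices.\<close>

lemma unit_path:
  assumes "i < n"
  obtains P where "pre_digraph.apath (ladder n) 0 P (2 * n - 1)"
    "\<And>u v. (u, v) \<in> arcs (ladder n) \<Longrightarrow> path_flow P (u, v) =
       (if v = u + 1 then of_bool (u = 2 * i)
        else if even u then of_bool (i > u div 2) else of_bool (i \<le> u div 2))"
proof -
  define S where "S = {v. if even v then i < v div 2 else v div 2 < i}"
  have "\<exists>P. skipping_path n S P"
  proof (rule ex_skipping_path)
    have "odd (2 * n - 1)" "(2 * n - 1) div 2 = n - 1"
      using assms by presburger+
    then show "2 * n - 1 \<notin> S"
      using assms by (simp add: S_def)
    show "Suc v \<notin> S" if "v \<in> S" for v
      using that by (cases "even v") (auto simp: S_def elim!: evenE oddE)
  qed (use assms in \<open>simp_all add: S_def\<close>)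
  then obtain P where P: "skipping_path n S P"
    by blast
  show ?thesis
  proof (rule that[OF skipping_path_apath[OF P]])
    fix u v
    assume uv: "(u, v) \<in> arcs (ladder n)"
    then show "path_flow P (u, v) =
       (if v = u + 1 then of_bool (u = 2 * i)
        else if even u then of_bool (i > u div 2) else of_bool (i \<le> u div 2))"
      unfolding skipping_path_flow[OF P uv] by (cases rule: ladder_arc_cases) (auto simp: S_def; presburger)+
  qed
qed

text \<open>Counts the paths through an arc: the long arc at \<open>2 * j\<close> is used for the
  indices \<open>i > j\<close>, the one at \<open>2 * j + 1\<close> for \<open>i \<le> j\<close>,
  and each rung by its own path only.\<close>

lemma residual_eq_sum_unit_paths:
  assumes "\<And>i u v. i < n \<Longrightarrow> (u, v) \<in> arcs (ladder n) \<Longrightarrow> path_flow (Q i) (u, v) =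
       (if v = u + 1 then of_bool (u = 2 * i)
        else if even u then of_bool (i > u div 2) else of_bool (i \<le> u div 2))"
    "e \<in> arcs (ladder n)"
  shows "residual n e = (\<Sum>i<n. path_flow (Q i) e)"
proof -
  obtain u v where e: "e = (u, v)" "v = u + 1 \<or> v = u + 2" "v < 2 * n"
    using assms(2) by (cases e) auto
  have "(\<Sum>i<n. path_flow (Q i) e) = (\<Sum>i<n. (if v = u + 1 then of_bool (u = 2 * i)
        else if even u then of_bool (i > u div 2) else of_bool (i \<le> u div 2)))"
    unfolding e(1) by (intro sum.cong) (use assms e(1) in auto)
  also have "\<dots> = residual n e"
  proof -
    have "(u, v) \<in> arcs (ladder n)"
      using assms(2) e(1) by simp
    then show ?thesis
    proof (cases rule: ladder_arc_cases)
      case (3 j)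
      have "{..<n} \<inter> {i. j < i} = {j<..<n}"
        by auto
      then show ?thesis
        using 3 e(1) by (simp add: residual_def sum.If_cases of_bool_def)
    next
      case (4 j)
      have "{..<n} \<inter> {i. i \<le> j} = {..j}"
        using 4 by auto
      then show ?thesis
        using 4 e(1) by (simp add: residual_def sum.If_cases of_bool_def)
    next
      case (2 j)
      then have "u \<noteq> 2 * i" for i
        by presburger
      then show ?thesis
        using 2 e(1) by (simp add: residual_def)
    qed (simp add: e(1) residual_def of_bool_def)
  qed
  finally show ?thesis
    by simp
qed

text \<open>Ensures that the bound for all runs is not vacuous. One run takes the spine and then the
  unit paths in order.\<close>

lemma ex_greedy_weight_ladder:
  assumes "n \<ge> 2"
  shows "\<exists>D. greedy_weight (ladder n) 0 (2 * n - 1) (ladder_flow n) D"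
proof -
  have "\<exists>P. pre_digraph.apath (ladder n) 0 P (2 * n - 1) \<and>
    (\<forall>u v. (u, v) \<in> arcs (ladder n) \<longrightarrow> path_flow P (u, v) =
       (if v = u + 1 then of_bool (u = 2 * i)
        else if even u then of_bool (i > u div 2) else of_bool (i \<le> u div 2)))" if "i < n" for i
    by (rule unit_path[OF that]) blast
  then obtain Q where Q: "\<And>i. i < n \<Longrightarrow> pre_digraph.apath (ladder n) 0 (Q i) (2 * n - 1)"
    "\<And>i u v. i < n \<Longrightarrow> (u, v) \<in> arcs (ladder n) \<Longrightarrow> path_flow (Q i) (u, v) =
       (if v = u + 1 then of_bool (u = 2 * i)
        else if even u then of_bool (i > u div 2) else of_bool (i \<le> u div 2))"
    by metis
  \<comment> \<open>What remains of \<open>residual\<close> after removal of the first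
    \<open>r\<close> unit paths.\<close>
  define R where "R r e = (\<Sum>i\<in>{r..<n}. path_flow (Q i) e)" for r e
  have residual: "residual n e = (\<Sum>i<n. path_flow (Q i) e)" if "e \<in> arcs (ladder n)" for e
    by (rule residual_eq_sum_unit_paths[OF _ that]) (rule Q(2))
  have R_le: "R r e \<le> residual n e" if "e \<in> arcs (ladder n)" for r e
    unfolding R_def residual[OF that]
    by (rule sum_mono2) auto
  have unit: "heaviest_path (ladder n) 0 (2 * n - 1) (R r) (Q r) 1" if "r < n" for r
    unfolding heaviest_path_def
  proof (intro conjI allI impI)
    show "pre_digraph.apath (ladder n) 0 (Q r) (2 * n - 1)"
      by (rule Q(1)[OF that])
    have "path_flow (Q r) e \<le> R r e" for e
      unfolding R_def by (rule member_le_sum) (use that in auto)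
    then show "carries (R r) (Q r) 1"
      unfolding carries_def by (metis path_flow_def)
    fix P q
    assume P: "pre_digraph.apath (ladder n) 0 P (2 * n - 1) \<and> carries (R r) P q"
    show "q \<le> 1"
    proof (rule ccontr)
      assume "\<not> q \<le> 1"
      have arc: "e \<in> arcs (ladder n)" "q \<le> residual n e" if "e \<in> set P" for e
      proof -
        show "e \<in> arcs (ladder n)"
          using that P by (auto simp: apath_ladder_iff)
        then show "q \<le> residual n e"
          using that P R_le[of e r] by (force simp: carries_def)
      qed
      \<comment> \<open>A path carrying at least 2 is confined to long arcs, which keep the parity,
        but it leads from 0 to an odd vertex.\<close>
      have "even u = even v" if "(u, v) \<in> set P" for u v
        using arc[OF that] \<open>\<not> q \<le> 1\<close> by (auto simp: residual_def of_bool_def split: if_splits)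
      then have "even (0 :: nat) = even (2 * n - 1)"
        using P cas_ladder_parity[of n 0 P "2 * n - 1"] unfolding apath_ladder_iff by blast
      then show False
        using assms by simp
    qed
  qed
  have "\<exists>D. greedy_weight (ladder n) 0 (2 * n - 1) (R r) D" if "r \<le> n" for r
    using that
  proof (induction r rule: inc_induct)
    case base
    have "greedy_weight (ladder n) 0 (2 * n - 1) (R n) []"
      by (rule greedy_weight.finished) (simp add: R_def)
    then show ?case
      by blast
  next
    case (step r)
    then obtain D where D: "greedy_weight (ladder n) 0 (2 * n - 1) (R (Suc r)) D"
      by blast
    have "(\<lambda>e. R r e - 1 * path_flow (Q r) e) = R (Suc r)"
      using step.hyps by (intro ext) (simp add: R_def sum.atLeast_Suc_lessThan)
    with D have "greedy_weight (ladder n) 0 (2 * n - 1) (\<lambda>e. R r e - 1 * path_flow (Q r) e) D"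
      by simp
    \<comment> \<open>The rung of \<open>Q r\<close> still carries flow, so the run is not finished
      yet.\<close>
    moreover have "(2 * r, 2 * r + 1) \<in> arcs (ladder n)" "R r (2 * r, 2 * r + 1) \<noteq> 0"
    proof -
      show "(2 * r, 2 * r + 1) \<in> arcs (ladder n)"
        using step.hyps by simp
      then have "path_flow (Q r) (2 * r, 2 * r + 1) = 1"
        using Q(2)[OF step.hyps(2)] by simp
      then show "R r (2 * r, 2 * r + 1) \<noteq> 0"
        using step.hyps by (auto simp: R_def intro!: bexI[of _ r])
    qed
    ultimately show ?case
      using unit[OF step.hyps(2)] by (blast intro: greedy_weight.step)
  qed
  from this[of 0] obtain D where D: "greedy_weight (ladder n) 0 (2 * n - 1) (R 0) D"
    by auto
  obtain P where P: "heaviest_path (ladder n) 0 (2 * n - 1) (ladder_flow n) P n"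
    using ex_heaviest_first_path assms by auto
  have "R 0 e = ladder_flow n e - n * path_flow P e" if "e \<in> arcs (ladder n)" for e
    unfolding residual_after_first[OF P assms that] residual[OF that]
    by (simp add: R_def lessThan_atLeast0)
  with D have "greedy_weight (ladder n) 0 (2 * n - 1) (\<lambda>e. ladder_flow n e - n * path_flow P e) D"
    by (rule greedy_weight_cong)
  moreover have "(0, 1) \<in> arcs (ladder n)" "ladder_flow n (0, 1) \<noteq> 0"
    using assms by (auto simp: ladder_flow_def residual_def)
  ultimately show ?thesis
    using P by (blast intro: greedy_weight.step)
qed

section \<open>A small decomposition from binary digits\<close>

lemma sum_bits_nat:
  fixes i k :: nat
  assumes "i < 2 ^ k"
  shows "(\<Sum>j<k. 2 ^ j * of_bool (bit i j)) = i"
proof -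
  have "take_bit k i = (\<Sum>j<k. 2 ^ j * of_bool (bit i j))"
    unfolding take_bit_sum lessThan_atLeast0
    by (intro sum.cong) (simp_all add: push_bit_eq_mult mult.commute)
  then show ?thesis
    using assms by (simp add: take_bit_nat_eq_self)
qed

lemma sum_not_bits_nat:
  fixes i k :: nat
  assumes "i < 2 ^ k"
  shows "(\<Sum>j<k. 2 ^ j * of_bool (\<not> bit i j)) = 2 ^ k - 1 - i"
proof -
  have "(\<Sum>j<k. 2 ^ j * of_bool (\<not> bit i j)) + (\<Sum>j<k. 2 ^ j * of_bool (bit i j)) = (\<Sum>j<k. 2 ^ j :: nat)"
    unfolding sum.distrib[symmetric] by (intro sum.cong) auto
  also have "\<dots> = 2 ^ k - 1"
    by (simp add: mask_eq_sum_exp_nat flip: lessThan_def)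
  finally show ?thesis
    using sum_bits_nat[OF assms] by simp
qed

lemma mfd_ladder_le:
  assumes "n = 2 ^ k"
  shows "mfd (ladder n) 0 (2 * n - 1) (ladder_flow n) \<le> 2 * k + 1"
proof -
  have n: "n > 0" "odd (2 * n - 1)" "(2 * n - 1) div 2 = n - 1"
    using assms by simp_all
  let ?a = "\<lambda>j. {v. even v \<and> bit (v div 2) j}"
  let ?b = "\<lambda>j. {v. odd v \<and> bit (n - 1 - v div 2) j}"
  \<comment> \<open>Each set has vertices of one parity only, so no two are consecutive. The
    endpoints are kept: 0 and \<open>2 * n - 1\<close> are assigned the number 0, which has no bit
    set.\<close>
  have "\<forall>j. \<exists>P. skipping_path n (?a j) P" "\<forall>j. \<exists>P. skipping_path n (?b j) P"
    using n by (auto intro!: ex_skipping_path)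
  then obtain A B where A: "\<And>j. skipping_path n (?a j) (A j)" and B: "\<And>j. skipping_path n (?b j) (B j)"
    by (elim choice[THEN exE]) blast
  obtain M where M: "skipping_path n {} M"
    using ex_skipping_path[of "{}" n] n by auto
  \<comment> \<open>The spine gets weight 2 because the other weights add up to
    \<open>2 * (2 ^ k - 1)\<close> and the flow has value \<open>2 * n\<close>.\<close>
  define D where "D = map (\<lambda>j. (A j, 2 ^ j)) [0..<k] @ map (\<lambda>j. (B j, 2 ^ j)) [0..<k] @ [(M, 2 :: nat)]"
  have "flow_decomposition (ladder n) 0 (2 * n - 1) (ladder_flow n) D"
    unfolding flow_decomposition_def
  proof (intro conjI ballI)
    fix x assume "x \<in> set D"
    then show "case x of (P, w) \<Rightarrow> pre_digraph.apath (ladder n) 0 P (2 * n - 1)"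
      using A[THEN skipping_path_apath] B[THEN skipping_path_apath] M[THEN skipping_path_apath]
      by (auto simp: D_def)
  next
    fix e assume "e \<in> arcs (ladder n)"
    obtain u v where e: "e = (u, v)"
      by (cases e)
    then have uv: "(u, v) \<in> arcs (ladder n)"
      using \<open>e \<in> _\<close> by simp
    have "(\<Sum>(P, w)\<leftarrow>D. w * path_flow P e) = (\<Sum>j<k. 2 ^ j * path_flow (A j) (u, v)) +
        (\<Sum>j<k. 2 ^ j * path_flow (B j) (u, v)) + 2 * path_flow M (u, v)"
      by (simp add: D_def e comp_def interv_sum_list_conv_sum_set_nat lessThan_atLeast0)
    also have "\<dots> = ladder_flow n (u, v)"
    proof -
      note flows = A[THEN skipping_path_flow, OF uv] B[THEN skipping_path_flow, OF uv]
        M[THEN skipping_path_flow, OF uv]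
      from uv show ?thesis
      proof (cases rule: ladder_arc_cases)
        \<comment> \<open>A short arc is used by the paths that skip neither end: here weight
          \<open>n - 1 - i\<close> from \<open>A\<close>, \<open>i\<close> from \<open>B\<close> and
          2 from \<open>M\<close>, in total \<open>n + 1\<close>.\<close>
        case (1 i)
        have "i < 2 ^ k" "n - 1 - i < 2 ^ k"
          using 1 assms by auto
        from this[THEN sum_not_bits_nat] show ?thesis
          unfolding flows using 1 assms by (simp add: ladder_flow_def residual_def)
      next
        case (2 i)
        have "i + 1 < 2 ^ k" "n - 1 - i < 2 ^ k"
          using 2 assms by auto
        from this[THEN sum_not_bits_nat] show ?thesis
          unfolding flows using 2 assms by (simp add: ladder_flow_def residual_def)
      next
        \<comment> \<open>A long arc is used exactly by the paths that skip its middle vertex, here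
          \<open>2 * i + 1\<close>.\<close>
        case (3 i)
        have "n - 1 - i < 2 ^ k"
          using assms by auto
        from sum_bits_nat[OF this] show ?thesis
          unfolding flows using 3 assms by (simp add: ladder_flow_def residual_def)
      next
        case (4 i)
        have "i + 1 < 2 ^ k"
          using 4 assms by auto
        from sum_bits_nat[OF this] show ?thesis
          unfolding flows using 4 assms by (simp add: ladder_flow_def residual_def)
      qed
    qed
    finally show "ladder_flow n e = (\<Sum>(P, w)\<leftarrow>D. w * path_flow P e)"
      by (simp add: e)
  qed
  then have "mfd (ladder n) 0 (2 * n - 1) (ladder_flow n) \<le> length D"
    unfolding mfd_def by (intro Least_le) blast
  then show ?thesis
    by (simp add: D_def)
qed

section \<open>The approximation ratio and the family of instances\<close>

text \<open>The constant 24 comes from \<open>4 * n - 3 \<le> 4 * n\<close>,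
  \<open>ln (4 * n - 3) \<ge> k / 2\<close> and \<open>2 * k + 1 \<le> 3 * k\<close>.\<close>

lemma ladder_ratio:
  assumes "n = 2 ^ k" "k \<ge> 1"
  shows "1 / 24 * (real (4 * n - 3) / ln (real (4 * n - 3))) *
    real (mfd (ladder n) 0 (2 * n - 1) (ladder_flow n)) \<le> real (n + 1)"
proof -
  let ?m = "real (4 * n - 3)"
  have n: "n \<ge> 2"
    using assms power_increasing[of 1 k "2 :: nat"] by simp
  have "1 / 2 \<le> ln (2 :: real)"
    using ln_le_minus_one[of "1 / 2 :: real"] by (simp add: ln_div)
  then have "real k * (1 / 2) \<le> real k * ln 2"
    by (intro mult_left_mono) auto
  also have "\<dots> = ln (real n)"
    using assms by (simp add: ln_realpow)
  also have "\<dots> \<le> ln ?m"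
    using n by (subst ln_le_cancel_iff) auto
  finally have ln: "real k / 2 \<le> ln ?m"
    by simp
  have "?m / ln ?m \<le> 4 * real n / (real k / 2)"
    using ln assms(2) n by (intro frac_le) auto
  moreover have "real (mfd (ladder n) 0 (2 * n - 1) (ladder_flow n)) \<le> 3 * real k"
    using mfd_ladder_le[OF assms(1)] assms(2) by linarith
  ultimately have "?m / ln ?m * real (mfd (ladder n) 0 (2 * n - 1) (ladder_flow n)) \<le>
      4 * real n / (real k / 2) * (3 * real k)"
    by (intro mult_mono) auto
  also have "\<dots> = 24 * real n"
    using assms(2) by simp
  finally show ?thesis
    by simp
qed

theorem theorem1:
  shows "\<exists>(c::real) (C::real). c > 0 \<and> C > 0 \<and>
    (\<exists>F :: ((nat, nat \<times> nat) pre_digraph \<times> nat \<times> nat \<times> (nat \<times> nat \<Rightarrow> nat)) set.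
       infinite F \<and>
       (\<forall>N::nat. \<exists>(G, s, t, X) \<in> F. card (arcs G) \<ge> N) \<and>
       (\<forall>(G, s, t, X) \<in> F.
          st_dag G s t \<and> is_flow G s t X \<and> (\<exists>e \<in> arcs G. X e \<noteq> 0) \<and>
          card (arcs G) \<ge> 2 \<and>
          real (card (arcs G)) \<le> C * real (card (verts G)) \<and>
          (\<exists>D. greedy_weight G s t X D) \<and>
          (\<forall>D. greedy_weight G s t X D \<longrightarrow>
             real (length D) \<ge>
               c * (real (card (arcs G)) / ln (real (card (arcs G)))) * real (mfd G s t X))))"
proof -
  define I where "I k = (let n = 2 ^ k in (ladder n, 0 :: nat, 2 * n - 1, ladder_flow n))" for k :: nat
  \<comment> \<open>Starting at \<open>k = 1\<close> gives \<open>n \<ge> 2\<close>, which the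
    bounds on greedy require, and keeps the divisor \<open>k / 2\<close> positive.\<close>
  define F where "F = I ` {1..}"
  have card: "card (arcs (fst (I k))) = 4 * 2 ^ k - 3" for k
    by (simp add: I_def Let_def card_arcs_ladder)
  have unbounded: "\<exists>x\<in>F. card (arcs (fst x)) \<ge> N" for N
  proof
    have "N < 2 ^ N" "1 \<le> (2 :: nat) ^ N"
      by simp_all
    then show "N \<le> card (arcs (fst (I (Suc N))))"
      unfolding card power_Suc by linarith
  qed (simp add: F_def)
  have "infinite F"
  proof
    assume "finite F"
    then have "finite ((\<lambda>x. card (arcs (fst x))) ` F)"
      by simp
    then obtain N where "\<forall>x\<in>F. card (arcs (fst x)) < N"
      unfolding finite_nat_set_iff_bounded by auto
    then show False
      using unbounded[of N] by force
  qed
  moreover have "st_dag G s t \<and> is_flow G s t X \<and> (\<exists>e\<in>arcs G. X e \<noteq> 0) \<and> card (arcs G) \<ge> 2 \<and>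
      real (card (arcs G)) \<le> 2 * real (card (verts G)) \<and> (\<exists>D. greedy_weight G s t X D) \<and>
      (\<forall>D. greedy_weight G s t X D \<longrightarrow> real (length D) \<ge>
         1 / 24 * (real (card (arcs G)) / ln (real (card (arcs G)))) * real (mfd G s t X))"
    if mem: "(G, s, t, X) \<in> F" for G s t X
  proof -
    obtain k where Ik: "(G, s, t, X) = I k" and "k \<in> {1..}"
      using mem unfolding F_def by blast
    then have "k \<ge> 1"
      by simp
    define n where "n = (2 :: nat) ^ k"
    note k = \<open>k \<ge> 1\<close> n_def
    have I: "G = ladder n" "s = 0" "t = 2 * n - 1" "X = ladder_flow n"
      using Ik by (simp_all add: I_def Let_def n_def)
    have n: "n \<ge> 2"
      using k power_increasing[of 1 k "2 :: nat"] by simp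
    then have m: "card (arcs G) = 4 * n - 3"
      unfolding I by (intro card_arcs_ladder) simp
    have "(0, 1) \<in> arcs G" "X (0, 1) \<noteq> 0"
      using n by (auto simp: I ladder_flow_def residual_def)
    \<comment> \<open>The choice \<open>C = 2\<close>: there are \<open>4 * n - 3\<close> arcs on
      \<open>2 * n\<close> vertices.\<close>
    moreover have "real (card (arcs G)) \<le> 2 * real (card (verts G))"
      unfolding m by (simp add: I)
    moreover have "1 / 24 * (real (card (arcs G)) / ln (real (card (arcs G)))) * real (mfd G s t X)
        \<le> real (length D)" if "greedy_weight G s t X D" for D
    proof -
      have "n + 1 \<le> length D"
        using that n unfolding I by (rule greedy_weight_ladder_length)
      then show ?thesis
        using ladder_ratio[OF k(2,1)] unfolding m unfolding I by linarith
    qed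
    moreover have "st_dag G s t" "is_flow G s t X" "\<exists>D. greedy_weight G s t X D"
      using n st_dag_ladder[of n] is_flow_ladder[of n] ex_greedy_weight_ladder[OF n] by (auto simp: I)
    moreover have "2 \<le> card (arcs G)"
      using n m by simp
    ultimately show ?thesis
      by blast
  qed
  moreover have "\<exists>(G, s, t, X)\<in>F. card (arcs G) \<ge> N" for N
    using unbounded[of N] by (simp add: case_prod_beta)
  ultimately show ?thesis
    by (intro exI[of _ "1 / 24"] exI[of _ 2] exI[of _ F] conjI allI ballI) auto
qed

end
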